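(* Let $n, m$ be nonnegative integers, and let $T_0(k)$ denote the number of labeled $T_0$ topologies on $k$ points. Then: (i) $T_0(n+m) \geq T_0(n)\, T_0(m)$. (ii) If $n+m\ge 2$, then $T_0(n+m) \geq \max\{ T_0(i)\, T_0(m+n-i) : 1 \leq i \leq n+m-1 \}$.
   Context: For a nonnegative integer $k$ and a finite set $E$ with $|E|=k$, a topology on $E$ (a topology on $k$ points) is a collection $\tau$ of subsets of $E$ containing $\emptyset$ and $E$ and closed under (pairwise) union and intersection. It is a $T_0$ topology if for any two distinct points $x,y \in E$ there exists $A \in \tau$ with $|\{x,y\} \cap A| = 1$. The number $T_0(k)$ of labeled $T_0$ topologies on $k$ points is the number of distinct $T_0$ topologies on a fixed set of cardinality $k$. *)

theory Defs
  imports "HOL-Analysis.Analysis"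
begin

(* The fixed set of k labels is {..<k}; the lemma number_T0_topologies_any_set shows that
   any other set of k points gives the same count. *)
definition number_T0_topologies :: "nat \<Rightarrow> nat" where
  "number_T0_topologies k = card {X :: nat topology. topspace X = {..<k} \<and> t0_space X}"

(* T0 topologies on a finite set E as families of subsets closed under pairwise
   union and intersection. *)
definition T0_families :: "'a set \<Rightarrow> 'a set set set" where
  "T0_families E = {\<tau>. \<tau> \<subseteq> Pow E \<and> {} \<in> \<tau> \<and> E \<in> \<tau> \<and>
      (\<forall>A\<in>\<tau>. \<forall>B\<in>\<tau>. A \<union> B \<in> \<tau> \<and> A \<inter> B \<in> \<tau>) \<and>
      (\<forall>x\<in>E. \<forall>y\<in>E. x \<noteq> y \<longrightarrow> (\<exists>A\<in>\<tau>. card ({x, y} \<inter> A) = 1))}"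

lemma card_pair_Int_eq_1:
  assumes "x \<noteq> y"
  shows "card ({x, y} \<inter> A) = 1 \<longleftrightarrow> (x \<notin> A \<longleftrightarrow> y \<in> A)"
  using assms by (cases "x \<in> A"; cases "y \<in> A") (auto simp: Int_insert_left)

(* For finite E, the open-set families of the library's T0 spaces with carrier E are
   exactly the members of T0_families E. *)
lemma bij_betw_T0_families:
  assumes "finite E"
  shows "bij_betw (\<lambda>X. {U. openin X U}) {X. topspace X = E \<and> t0_space X} (T0_families E)"
proof (rule bij_betw_imageI)
  show "inj_on (\<lambda>X. {U. openin X U}) {X. topspace X = E \<and> t0_space X}"
    by (auto simp: inj_on_def topology_eq)
  show "(\<lambda>X. {U. openin X U}) ` {X. topspace X = E \<and> t0_space X} = T0_families E"
  proof (intro equalityI subsetI)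
    fix \<tau> assume "\<tau> \<in> (\<lambda>X. {U. openin X U}) ` {X. topspace X = E \<and> t0_space X}"
    then obtain X where X: "\<tau> = {U. openin X U}" "topspace X = E" "t0_space X"
      by auto
    have "\<exists>A\<in>\<tau>. card ({x, y} \<inter> A) = 1" if "x \<in> E" "y \<in> E" "x \<noteq> y" for x y
      using X that card_pair_Int_eq_1[OF \<open>x \<noteq> y\<close>] unfolding t0_space_def by auto
    then show "\<tau> \<in> T0_families E"
      using X openin_subset[of X] openin_topspace[of X] unfolding T0_families_def by auto
  next
    fix \<tau> assume \<tau>: "\<tau> \<in> T0_families E"
    have sub: "\<tau> \<subseteq> Pow E" and E: "E \<in> \<tau>" using \<tau> by (auto simp: T0_families_def)
    have Un: "\<Union>K \<in> \<tau>" if "K \<subseteq> \<tau>" for K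
    proof -
      have "finite K"
        using that sub assms by (meson finite_Pow_iff finite_subset)
      then show ?thesis using that
        by (induction K rule: finite_induct) (use \<tau> in \<open>auto simp: T0_families_def\<close>)
    qed
    have "istopology (\<lambda>U. U \<in> \<tau>)"
    proof (unfold istopology_def, intro conjI allI impI)
      fix S T assume "S \<in> \<tau>" "T \<in> \<tau>"
      then show "S \<inter> T \<in> \<tau>" using \<tau> by (auto simp: T0_families_def)
    next
      fix K assume "\<forall>S\<in>K. S \<in> \<tau>"
      then show "\<Union>K \<in> \<tau>" by (intro Un) auto
    qed
    then have op: "openin (topology (\<lambda>U. U \<in> \<tau>)) = (\<lambda>U. U \<in> \<tau>)" by simp
    have top: "topspace (topology (\<lambda>U. U \<in> \<tau>)) = E"
      unfolding topspace_def op using sub E by auto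
    have "t0_space (topology (\<lambda>U. U \<in> \<tau>))"
    proof (unfold t0_space_def top op, intro ballI impI)
      fix x y assume "x \<in> E" "y \<in> E" "x \<noteq> y"
      then obtain A where "A \<in> \<tau>" "card ({x, y} \<inter> A) = 1"
        using \<tau> unfolding T0_families_def by blast
      then show "\<exists>U. U \<in> \<tau> \<and> (x \<notin> U \<longleftrightarrow> y \<in> U)"
        using card_pair_Int_eq_1[OF \<open>x \<noteq> y\<close>] by blast
    qed
    then show "\<tau> \<in> (\<lambda>X. {U. openin X U}) ` {X. topspace X = E \<and> t0_space X}"
      using op top by (intro image_eqI[of _ _ "topology (\<lambda>U. U \<in> \<tau>)"]) auto
  qed
qed

lemma card_T0_families_le:
  assumes f: "bij_betw f E F" and fin: "finite F"
  shows "card (T0_families E) \<le> card (T0_families F)"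
proof (rule card_inj_on_le[where f = "(`) ((`) f)"])
  have inj: "inj_on f E" and F: "F = f ` E" using f by (auto simp: bij_betw_def)
  have "inj_on ((`) ((`) f)) (Pow (Pow E))"
    by (intro inj_on_image_Pow inj)
  then show "inj_on ((`) ((`) f)) (T0_families E)"
    by (rule inj_on_subset) (auto simp: T0_families_def)
  have "T0_families F \<subseteq> Pow (Pow F)" by (auto simp: T0_families_def)
  then show "finite (T0_families F)" using fin by (meson finite_Pow_iff finite_subset)
  show "(`) ((`) f) ` T0_families E \<subseteq> T0_families F"
  proof (intro image_subsetI)
    fix \<tau> assume \<tau>: "\<tau> \<in> T0_families E"
    then have sub: "\<And>A. A \<in> \<tau> \<Longrightarrow> A \<subseteq> E" by (auto simp: T0_families_def)
    have "f ` A \<union> f ` B \<in> (`) f ` \<tau> \<and> f ` A \<inter> f ` B \<in> (`) f ` \<tau>" if "A \<in> \<tau>" "B \<in> \<tau>" for A B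
    proof -
      have "f ` A \<union> f ` B = f ` (A \<union> B)" "f ` A \<inter> f ` B = f ` (A \<inter> B)"
        using inj_on_image_Int[OF inj sub sub] that by auto
      then show ?thesis using that \<tau> by (auto simp: T0_families_def)
    qed
    moreover have "\<exists>A\<in>\<tau>. card ({f x, f y} \<inter> f ` A) = 1"
      if xy: "x \<in> E" "y \<in> E" "f x \<noteq> f y" for x y
    proof -
      have "x \<noteq> y" using xy by auto
      with \<tau> xy have "\<exists>A\<in>\<tau>. card ({x, y} \<inter> A) = 1"
        unfolding T0_families_def by blast
      then obtain A where A: "A \<in> \<tau>" "card ({x, y} \<inter> A) = 1" by blast
      have "{f x, f y} \<inter> f ` A = f ` ({x, y} \<inter> A)"
        using inj_on_image_Int[OF inj, of "{x, y}" A] xy sub[OF A(1)] by auto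
      moreover have "inj_on f ({x, y} \<inter> A)"
        using inj by (rule inj_on_subset) (use xy in auto)
      ultimately show ?thesis using A by (metis card_image)
    qed
    moreover have "(`) f ` \<tau> \<subseteq> Pow F" using sub F by auto
    moreover have "{} \<in> (`) f ` \<tau>" "F \<in> (`) f ` \<tau>"
      using \<tau> F by (auto simp: T0_families_def)
    ultimately show "(`) f ` \<tau> \<in> T0_families F"
      unfolding T0_families_def mem_Collect_eq F ball_simps by simp
  qed
qed

lemma number_T0_topologies_any_set:
  fixes E :: "'a set"
  assumes "finite E"
  shows "number_T0_topologies (card E) = card (T0_families E)"
    and "number_T0_topologies (card E) = card {X. topspace X = E \<and> t0_space X}"
proof -
  obtain f where f: "bij_betw f {..<card E} E"
    using ex_bij_betw_nat_finite[OF assms] by (auto simp: atLeast0LessThan)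
  have "card (T0_families {..<card E}) = card (T0_families E)"
    using card_T0_families_le[OF f assms] card_T0_families_le[OF bij_betw_inv_into[OF f]]
    by simp
  then show "number_T0_topologies (card E) = card (T0_families E)"
    using bij_betw_same_card[OF bij_betw_T0_families[of "{..<card E}"]]
    by (simp add: number_T0_topologies_def)
  then show "number_T0_topologies (card E) = card {X. topspace X = E \<and> t0_space X}"
    using bij_betw_same_card[OF bij_betw_T0_families[OF assms]] by simp
qed

end

theory Submission
  imports Defs
begin

text \<open>
  Topologies on two disjoint sets of points determine one on their union, the disjoint sum,
  whose open sets are the unions of an open set of each summand. The sum of \<open>T\<^sub>0\<close> topologies
  is \<open>T\<^sub>0\<close>: a pair inside one summand is separated there, and a pair across the two summands is
  separated by the open set that is a whole summand. Each summand is recovered from the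
  sum as the subspace topology, so the sum is injective on pairs of topologies. Splitting a set of
  \<open>n + m\<close> points into \<open>n\<close> and \<open>m\<close> points gives the product bound, and the bound by
  the maximum is the product bound for every splitting of the same set.
\<close>

definition sum_family :: "'a set \<Rightarrow> 'a set \<Rightarrow> 'a set set \<Rightarrow> 'a set set \<Rightarrow> 'a set set" where
  "sum_family A B \<sigma> \<tau> = {W. W \<subseteq> A \<union> B \<and> W \<inter> A \<in> \<sigma> \<and> W \<inter> B \<in> \<tau>}"

text \<open>
  Since the empty set is open in the other summand, the open sets of a summand are the
  open sets of the sum that lie inside it; this is what makes the sum injective.
\<close>

lemma sum_family_Int_Pow:
  assumes "A \<inter> B = {}" "\<sigma> \<in> T0_families A" "\<tau> \<in> T0_families B"
  shows "sum_family A B \<sigma> \<tau> \<inter> Pow A = \<sigma>" "sum_family A B \<sigma> \<tau> \<inter> Pow B = \<tau>"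
proof -
  have A: "U \<inter> A = U" "U \<inter> B = {}" if "U \<subseteq> A" for U
    using that assms(1) by auto
  have B: "V \<inter> B = V" "V \<inter> A = {}" if "V \<subseteq> B" for V
    using that assms(1) by auto
  have \<sigma>: "\<sigma> \<subseteq> Pow A" "{} \<in> \<sigma>" and \<tau>: "\<tau> \<subseteq> Pow B" "{} \<in> \<tau>"
    using assms(2,3) by (simp_all add: T0_families_def)
  have "U \<in> sum_family A B \<sigma> \<tau> \<longleftrightarrow> U \<in> \<sigma>" if "U \<subseteq> A" for U
    using A[OF that] \<tau>(2) that by (simp add: sum_family_def le_supI1)
  then show "sum_family A B \<sigma> \<tau> \<inter> Pow A = \<sigma>" using \<sigma>(1) by blast
  have "V \<in> sum_family A B \<sigma> \<tau> \<longleftrightarrow> V \<in> \<tau>" if "V \<subseteq> B" for V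
    using B[OF that] \<sigma>(2) that by (simp add: sum_family_def le_supI2)
  then show "sum_family A B \<sigma> \<tau> \<inter> Pow B = \<tau>" using \<tau>(1) by blast
qed

lemma sum_family_T0:
  assumes disj: "A \<inter> B = {}" and \<sigma>: "\<sigma> \<in> T0_families A" and \<tau>: "\<tau> \<in> T0_families B"
  shows "sum_family A B \<sigma> \<tau> \<in> T0_families (A \<union> B)"
proof -
  let ?S = "sum_family A B \<sigma> \<tau>"
  note sub = sum_family_Int_Pow[OF assms]
  have mem: "{} \<in> \<sigma>" "A \<in> \<sigma>" "{} \<in> \<tau>" "B \<in> \<tau>"
    using \<sigma> \<tau> by (auto simp: T0_families_def)
  have \<sigma>_lattice: "U \<union> V \<in> \<sigma>" "U \<inter> V \<in> \<sigma>" if "U \<in> \<sigma>" "V \<in> \<sigma>" for U V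
    using \<sigma> that by (simp_all add: T0_families_def)
  have \<tau>_lattice: "U \<union> V \<in> \<tau>" "U \<inter> V \<in> \<tau>" if "U \<in> \<tau>" "V \<in> \<tau>" for U V
    using \<tau> that by (simp_all add: T0_families_def)
  have lattice: "U \<union> V \<in> ?S \<and> U \<inter> V \<in> ?S" if UV: "U \<in> ?S" "V \<in> ?S" for U V
  proof -
    have "(U \<union> V) \<inter> C = (U \<inter> C) \<union> (V \<inter> C)" "(U \<inter> V) \<inter> C = (U \<inter> C) \<inter> (V \<inter> C)" for C
      by auto
    moreover have "U \<subseteq> A \<union> B" "V \<subseteq> A \<union> B" "U \<inter> A \<in> \<sigma>" "V \<inter> A \<in> \<sigma>" "U \<inter> B \<in> \<tau>" "V \<inter> B \<in> \<tau>"
      using UV by (simp_all add: sum_family_def)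
    ultimately show ?thesis
      by (simp add: sum_family_def \<sigma>_lattice \<tau>_lattice le_infI1)
  qed
  have separation: "\<exists>W\<in>?S. card ({x, y} \<inter> W) = 1"
    if xy: "x \<in> A \<union> B" "y \<in> A \<union> B" "x \<noteq> y" for x y
  proof -
    consider "x \<in> A" "y \<in> A" | "x \<in> B" "y \<in> B" | "x \<in> A \<longleftrightarrow> y \<notin> A"
      using xy by auto
    then show ?thesis
    proof cases
      case 1
      then have "\<exists>W\<in>\<sigma>. card ({x, y} \<inter> W) = 1"
        using \<sigma> xy unfolding T0_families_def by blast
      then show ?thesis using sub(1) by blast
    next
      case 2
      then have "\<exists>W\<in>\<tau>. card ({x, y} \<inter> W) = 1"
        using \<tau> xy unfolding T0_families_def by blast
      then show ?thesis using sub(2) by blast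
    next
      case 3
      have "A \<in> ?S" using sub(1) mem(2) by blast
      moreover have "card ({x, y} \<inter> A) = 1"
        using 3 card_pair_Int_eq_1[OF xy(3), of A] by blast
      ultimately show ?thesis by blast
    qed
  qed
  have "(A \<union> B) \<inter> A = A" "(A \<union> B) \<inter> B = B" by auto
  then have bounds: "?S \<subseteq> Pow (A \<union> B)" "{} \<in> ?S" "A \<union> B \<in> ?S"
    using mem by (auto simp: sum_family_def)
  show ?thesis
    unfolding T0_families_def mem_Collect_eq
    by (intro conjI ballI impI bounds separation)
      (rule lattice[THEN conjunct1] lattice[THEN conjunct2]; assumption)+
qed

lemma card_T0_families_mult_le:
  assumes "A \<inter> B = {}" "finite A" "finite B"
  shows "card (T0_families A) * card (T0_families B) \<le> card (T0_families (A \<union> B))"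
proof -
  have "card (T0_families A \<times> T0_families B) \<le> card (T0_families (A \<union> B))"
  proof (rule card_inj_on_le[where f = "\<lambda>(\<sigma>, \<tau>). sum_family A B \<sigma> \<tau>"])
    show "inj_on (\<lambda>(\<sigma>, \<tau>). sum_family A B \<sigma> \<tau>) (T0_families A \<times> T0_families B)"
    proof (rule inj_onI, clarsimp)
      fix \<sigma> \<tau> \<sigma>' \<tau>'
      assume mem: "\<sigma> \<in> T0_families A" "\<tau> \<in> T0_families B"
          "\<sigma>' \<in> T0_families A" "\<tau>' \<in> T0_families B"
        and eq: "sum_family A B \<sigma> \<tau> = sum_family A B \<sigma>' \<tau>'"
      show "\<sigma> = \<sigma>' \<and> \<tau> = \<tau>'"
        using sum_family_Int_Pow[OF assms(1) mem(1,2)]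
          sum_family_Int_Pow[OF assms(1) mem(3,4)] eq by simp
    qed
    show "(\<lambda>(\<sigma>, \<tau>). sum_family A B \<sigma> \<tau>) ` (T0_families A \<times> T0_families B)
        \<subseteq> T0_families (A \<union> B)"
      using sum_family_T0[OF assms(1)] by auto
    have "T0_families (A \<union> B) \<subseteq> Pow (Pow (A \<union> B))"
      by (auto simp: T0_families_def)
    then show "finite (T0_families (A \<union> B))"
      using assms(2,3) by (meson finite_Pow_iff finite_UnI finite_subset)
  qed
  then show ?thesis by (simp add: card_cartesian_product)
qed

lemma number_T0_topologies_mult_le:
  "number_T0_topologies n * number_T0_topologies m \<le> number_T0_topologies (n + m)"
proof -
  let ?A = "{..<n}" and ?B = "{n..<n + m}"
  have "?A \<inter> ?B = {}" "?A \<union> ?B = {..<n + m}" by auto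
  then show ?thesis
    using card_T0_families_mult_le[of ?A ?B]
      number_T0_topologies_any_set(1)[of ?A] number_T0_topologies_any_set(1)[of ?B]
      number_T0_topologies_any_set(1)[of "{..<n + m}"] by simp
qed

theorem corollary3p6:
  fixes n m :: nat
  shows "number_T0_topologies (n + m) \<ge> number_T0_topologies n * number_T0_topologies m \<and>
    (n + m \<ge> 2 \<longrightarrow>
      number_T0_topologies (n + m) \<ge>
        Max {number_T0_topologies i * number_T0_topologies (m + n - i) | i. 1 \<le> i \<and> i \<le> n + m - 1})"
proof (intro conjI impI)
  show "number_T0_topologies n * number_T0_topologies m \<le> number_T0_topologies (n + m)"
    by (rule number_T0_topologies_mult_le)
next
  assume "2 \<le> n + m"
  let ?f = "\<lambda>i. number_T0_topologies i * number_T0_topologies (m + n - i)"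
  have set_eq: "{?f i | i. 1 \<le> i \<and> i \<le> n + m - 1} = ?f ` {1..n + m - 1}"
    by auto
  have "?f i \<le> number_T0_topologies (n + m)" if "i \<in> {1..n + m - 1}" for i
  proof -
    have "i + (m + n - i) = n + m" using that by auto
    then show ?thesis using number_T0_topologies_mult_le[of i "m + n - i"] by simp
  qed
  then show "Max {?f i | i. 1 \<le> i \<and> i \<le> n + m - 1} \<le> number_T0_topologies (n + m)"
    unfolding set_eq using \<open>2 \<le> n + m\<close> by (subst Max_le_iff) auto
qed

end
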